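(* Let $A(r)$, $P^D$, $S(r)$, $\Lambda(r)$, $\overline\Lambda(r)$, $\overline A(r)$ be as defined in the context, with $A(r)$ diagonalizable, and let the frequency deviation $\omega(t)\in\mathbb{R}^n$ be the vector of the first $n$ components of the solution of $\dot x=A(r)x+P^D$, $x(0)=0$. Put $$Y(r)=S(r)\,\overline\Lambda^{-1}(r)\operatorname{diag}\big(S^{-1}(r)P^D\big),\qquad \omega^*=\big(\overline A^{-1}(r)P^D\big)_N .$$ Then for all $t\ge0$, elementwise, $$|\omega(t)|\le|Y_N(r)|\,e^{\operatorname{Re}\Lambda(r)\,\rho\, t}+|\omega^*|.$$
   Context: Let $(N,E)$ be a connected directed graph (connected as an undirected graph) with $N=\{1,\dots,n\}$ and $m$ edges, and let $C\in\mathbb{R}^{n\times m}$ be its incidence matrix (the column of edge $(l,j)$ has entry $+1$ in row $l$, $-1$ in row $j$, and $0$ elsewhere). Let $D=\operatorname{diag}(d_1,\dots,d_n)$, $M=\operatorname{diag}(1/m_1,\dots,1/m_n)$, $B=\operatorname{diag}(b_1,\dots,b_m)$, $T^G=\operatorname{diag}(1/t^G_1,\dots,1/t^G_n)$, $T^V=\operatorname{diag}(1/t^V_1,\dots,1/t^V_n)$, $R=\operatorname{diag}(r_1,\dots,r_n)$, all with strictly positive real diagonal entries, and let $p^D\in\mathbb{R}^n$ be a constant vector. Set $$A(r)=\begin{pmatrix}-MD&-MC&M&\mathbf 0\\ BC^T&\mathbf 0&\mathbf 0&\mathbf 0\\ \mathbf 0&\mathbf 0&-T^G&T^G\\ -T^VR&\mathbf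 0&\mathbf 0&-T^V\end{pmatrix}\in\mathbb{R}^{(3n+m)\times(3n+m)},\qquad P^D=\begin{pmatrix}Mp^D\\0\\0\\0\end{pmatrix}.$$ The state is $x=(\omega,p,p^M,v)$ with $\omega,p^M,v\in\mathbb{R}^n$, $p\in\mathbb{R}^m$. Standing assumption: $A(r)$ is diagonalizable (over $\mathbb{C}$), with $A(r)=S(r)\Lambda(r)S^{-1}(r)$ and $$\Lambda(r)=\begin{pmatrix}\Lambda^1(r)&\mathbf 0\\ \mathbf 0&\mathbf 0\end{pmatrix},$$ where $\Lambda^1(r)$ is the diagonal matrix of the nonzero eigenvalues. Define $$\overline\Lambda(r)=\begin{pmatrix}\Lambda^1(r)&\mathbf 0\\ \mathbf 0&-I\end{pmatrix},\qquad \overline A(r)=S(r)\overline\Lambda(r)S^{-1}(r).$$ Notation: for a vector $u$, $\operatorname{diag}(u)$ is the diagonal matrix with the entries of $u$ on its diagonal. For a matrix (vector) $X$, $X_N$ is the submatrix (subvector) formed by the rows (entries) with indices in $N=\{1,\dots,n\}$. The operations $|\cdot|$ and $\operatorname{Re}$ and the inequality between vectors are elementwise. $\rho$ is the all-ones vector in $\mathbb{R}^{3n+m}$, and the exponential of a vector is taken elementwise, so $e^{\operatorname{Re}\Lambda(r)\rho t}$ is the vector with entries $e^{\operatorname{Re}\lambda_j(r)\,t}$, where $\lambda_j(r)$ are the diagonal entries of $\Lambda(r)$. *)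

theory Defs
  imports
    Complex_Main
    "Jordan_Normal_Form.Matrix"
    "Jordan_Normal_Form.Gauss_Jordan_Elimination"
    "Jordan_Normal_Form.DL_Submatrix"
    "Graph_Theory.Digraph_Component"
begin

text \<open>Nodes and edges are numbered from 0, so the node set \<open>N = {1,...,n}\<close> becomes
  \<open>{0..<n}\<close>, and the edge set is indexed by \<open>{0..<m}\<close>. Matrices with explicit dimensions
  are used so that \<open>n = 1, m = 0\<close> (a single node without edges) is included.\<close>

definition incidence_mat :: "(nat, nat) pre_digraph \<Rightarrow> nat \<Rightarrow> nat \<Rightarrow> real mat" where
  "incidence_mat G n m =
     mat n m (\<lambda>(i, e). if i = tail G e then 1 else if i = head G e then - 1 else 0)"

definition diag :: "'a::zero vec \<Rightarrow> 'a mat" where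
  "diag u = mat_diag (dim_vec u) (\<lambda>i. u $ i)"

definition diag_recip :: "real vec \<Rightarrow> real mat" where
  "diag_recip u = diag (map_vec (\<lambda>a. 1 / a) u)"

text \<open>Only meaningful for invertible matrices (the library function returns an option).\<close>

definition minv :: "'a::field mat \<Rightarrow> 'a mat" where
  "minv X = the (mat_inverse X)"

text \<open>The block matrix \<open>A(r)\<close>, with block rows and columns ordered \<open>\<omega>, p, p\<^sup>M, v\<close> of sizes
  \<open>n, m, n, n\<close>. The outer \<open>2 \<times> 2\<close> blocks group \<open>(\<omega>, p)\<close> and \<open>(p\<^sup>M, v)\<close>.
  Here \<open>h\<close> is the vector of the inertias \<open>m\<^sub>1, ..., m\<^sub>n\<close>.\<close>

definition system_mat ::
  "(nat, nat) pre_digraph \<Rightarrow> nat \<Rightarrow> nat \<Rightarrow> real vec \<Rightarrow> real vec \<Rightarrow> real vec \<Rightarrow>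
   real vec \<Rightarrow> real vec \<Rightarrow> real vec \<Rightarrow> real mat" where
  "system_mat G n m d h b tG tV r =
    (let C = incidence_mat G n m; D = diag d; M = diag_recip h; B = diag b;
         TG = diag_recip tG; TV = diag_recip tV; R = diag r
     in four_block_mat
          (four_block_mat (- (M * D)) (- (M * C))
                          (B * transpose_mat C) (0\<^sub>m m m))
          (four_block_mat M (0\<^sub>m n n)
                          (0\<^sub>m m n) (0\<^sub>m m n))
          (four_block_mat (0\<^sub>m n n) (0\<^sub>m n m)
                          (- (TV * R)) (0\<^sub>m n m))
          (four_block_mat (- TG) TG
                          (0\<^sub>m n n) (- TV)))"

definition disturbance_vec :: "nat \<Rightarrow> nat \<Rightarrow> real vec \<Rightarrow> real vec \<Rightarrow> real vec" where
  "disturbance_vec n m h pD = (diag_recip h *\<^sub>v pD) @\<^sub>v 0\<^sub>v m @\<^sub>v 0\<^sub>v n @\<^sub>v 0\<^sub>v n"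

text \<open>\<open>x\<close> solves \<open>x' = A x + u\<close>, \<open>x(0) = 0\<close> on \<open>[0, \<infinity>)\<close> (one-sided derivative at 0).\<close>

definition solves_from_zero :: "real mat \<Rightarrow> real vec \<Rightarrow> (real \<Rightarrow> real vec) \<Rightarrow> bool" where
  "solves_from_zero A u x \<longleftrightarrow>
     (\<forall>t\<ge>0. x t \<in> carrier_vec (dim_row A)) \<and> x 0 = 0\<^sub>v (dim_row A) \<and>
     (\<forall>t\<ge>0. \<forall>i<dim_row A.
        ((\<lambda>s. x s $ i) has_real_derivative (A *\<^sub>v x t + u) $ i) (at t within {0..}))"

text \<open>\<open>\<Lambda>\<close> and \<open>\<Lambda>\<close>-bar, given the block \<open>\<Lambda>\<^sup>1\<close>; \<open>q\<close> is the size of the other diagonal block.\<close>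

definition Lam :: "nat \<Rightarrow> complex mat \<Rightarrow> complex mat" where
  "Lam q L1 = four_block_mat L1 (0\<^sub>m (dim_row L1) q) (0\<^sub>m q (dim_col L1)) (0\<^sub>m q q)"

definition Lam_bar :: "nat \<Rightarrow> complex mat \<Rightarrow> complex mat" where
  "Lam_bar q L1 = four_block_mat L1 (0\<^sub>m (dim_row L1) q) (0\<^sub>m q (dim_col L1)) (- 1\<^sub>m q)"

definition A_bar :: "complex mat \<Rightarrow> nat \<Rightarrow> complex mat \<Rightarrow> complex mat" where
  "A_bar S q L1 = S * Lam_bar q L1 * minv S"

definition Y_mat :: "complex mat \<Rightarrow> nat \<Rightarrow> complex mat \<Rightarrow> complex vec \<Rightarrow> complex mat" where
  "Y_mat S q L1 P = S * minv (Lam_bar q L1) * diag (minv S *\<^sub>v P)"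

definition omega_star :: "nat \<Rightarrow> complex mat \<Rightarrow> nat \<Rightarrow> complex mat \<Rightarrow> complex vec \<Rightarrow> complex vec"
  where "omega_star n S q L1 P = vec_first (minv (A_bar S q L1) *\<^sub>v P) n"

text \<open>Submatrix formed by the rows with index in \<open>N = {0..<n}\<close>.\<close>

definition rows_N :: "nat \<Rightarrow> 'a mat \<Rightarrow> 'a mat" where
  "rows_N n X = submatrix X {0..<n} UNIV"

text \<open>Entry \<open>j\<close> is \<open>exp (t * Re \<lambda>\<^sub>j)\<close>: \<open>L\<close> is diagonal and is applied to the all-ones vector \<open>\<rho>\<close>.\<close>

definition exp_Re_Lam :: "complex mat \<Rightarrow> real \<Rightarrow> real vec" where
  "exp_Re_Lam L t = map_vec exp (t \<cdot>\<^sub>v (map_mat Re L *\<^sub>v vec (dim_col L) (\<lambda>_. 1)))"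

end

theory Submission
  imports Defs
begin

text \<open>
  In the eigencoordinates \<open>z = S\<^sup>-\<^sup>1 x\<close> the system decouples into scalar equations
  \<open>z\<^sub>j' = \<lambda>\<^sub>j z\<^sub>j + g\<^sub>j\<close> with \<open>z\<^sub>j(0) = 0\<close> and \<open>g = S\<^sup>-\<^sup>1 P\<close>. For \<open>\<lambda>\<^sub>j \<noteq> 0\<close> the solution is
  \<open>z\<^sub>j(t) = (exp (\<lambda>\<^sub>j t) - 1) g\<^sub>j / \<lambda>\<^sub>j\<close> (lemmas \<open>scalar_affine_ode_from_zero\<close> and
  \<open>solves_from_zero_coordinate\<close>). A coordinate with \<open>\<lambda>\<^sub>j = 0\<close> is \<open>g\<^sub>j t\<close>, for which a bound of
  this kind has no room. Such coordinates never reach \<open>\<omega>\<close>, however: the first \<open>n\<close> entries of every vector in the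
  kernel of \<open>A\<close> vanish.

  This last fact (\<open>system_mat_kernel_frequency_zero\<close>) is an energy argument. Eliminating \<open>p\<^sup>M\<close> and
  \<open>v\<close> from \<open>A u = 0\<close> leaves \<open>C\<^sup>T \<omega> = 0\<close> and \<open>(D + R) \<omega> + C p = 0\<close>. The inner product of the second
  equation with \<open>\<omega>\<close> loses the term \<open>\<omega> \<bullet> C p = C\<^sup>T \<omega> \<bullet> p = 0\<close>, so \<open>\<Sum>i. (d\<^sub>i + r\<^sub>i) \<omega>\<^sub>i\<^sup>2 = 0\<close> with
  positive weights.

  Hence \<open>S\<^sub>i\<^sub>j = 0\<close>, and so \<open>Y\<^sub>i\<^sub>j = 0\<close>, for \<open>i\<close> in \<open>N\<close> and \<open>\<lambda>\<^sub>j = 0\<close>; for all other \<open>j\<close>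
  the matrices \<open>\<Lambda>\<close> and \<open>\<Lambda>\<close>-bar have the same diagonal entry. This gives
  \<open>\<omega>\<^sub>i(t) = (\<Sum>j. Y\<^sub>i\<^sub>j exp (\<lambda>\<^sub>j t)) - (\<Sum>j. Y\<^sub>i\<^sub>j)\<close>, whose second sum is \<open>\<omega>\<^sup>*\<^sub>i\<close>, because the inverse of
  \<open>A\<close>-bar is diagonal in the same eigenbasis. The triangle inequality gives the bound.
\<close>

section \<open>Scalar linear equations\<close>

lemma zero_derivative_halfline_constant:
  fixes f :: "real \<Rightarrow> real"
  assumes der: "\<And>s. s \<ge> 0 \<Longrightarrow> (f has_vector_derivative 0) (at s within {0..})" and t: "t \<ge> 0"
  shows "f t = f 0"
proof (cases "t = 0")
  case False
  have D: "(f has_real_derivative 0) (at s within {0..})" if "s \<ge> 0" for s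
    using der[OF that] by (simp add: has_real_derivative_iff_has_vector_derivative)
  show ?thesis
  proof (rule DERIV_isconst_end[of 0 t f])
    show "0 < t" using False t by simp
    have "continuous_on {0..} f" using D by (intro DERIV_continuous_on) auto
    then show "continuous_on {0..t} f" by (rule continuous_on_subset) auto
    fix s :: real assume "0 < s"
    then have "at s within {0..} = at s"
      by (intro at_within_open_subset[of _ "{0<..}"]) auto
    then show "DERIV f s :> 0" using D[of s] \<open>0 < s\<close> by simp
  qed
qed simp

text \<open>The integrating factor \<open>exp (- c t)\<close> turns the deviation of \<open>z\<close> from its equilibrium \<open>- g / c\<close>
  into a constant.\<close>

lemma scalar_affine_ode_from_zero:
  fixes z :: "real \<Rightarrow> complex"
  assumes nz: "c \<noteq> 0" and z0: "z 0 = 0"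
    and ode: "\<And>t. t \<ge> 0 \<Longrightarrow> (z has_vector_derivative c * z t + g) (at t within {0..})"
    and t: "t \<ge> 0"
  shows "z t = (exp (c * of_real t) - 1) * (g / c)"
proof -
  define y where "y s = exp (- (c * of_real s)) * (z s + g / c)" for s
  have e: "((\<lambda>s. exp (- (c * complex_of_real s))) has_vector_derivative
      - (c * exp (- (c * of_real s)))) (at s within {0..})" for s
    by (rule has_vector_derivative_real_field[where f = "\<lambda>u. exp (- (c * u))"])
      (auto intro!: derivative_eq_intros)
  have y': "(y has_vector_derivative 0) (at s within {0..})" if "s \<ge> 0" for s
  proof -
    have "((\<lambda>s. z s + g / c) has_vector_derivative c * z s + g) (at s within {0..})"
      using has_vector_derivative_add[OF ode has_vector_derivative_const, of s "g / c"] that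
      by simp
    from has_vector_derivative_mult[OF e this] show ?thesis
      unfolding y_def using nz by (simp add: field_simps)
  qed
  have "Re (y t) = Re (y 0)" "Im (y t) = Im (y 0)"
    using zero_derivative_halfline_constant[OF _ t, of "\<lambda>s. Re (y s)"]
      zero_derivative_halfline_constant[OF _ t, of "\<lambda>s. Im (y s)"]
      bounded_linear.has_vector_derivative[OF bounded_linear_Re y']
      bounded_linear.has_vector_derivative[OF bounded_linear_Im y'] by auto
  then have "y t = y 0" by (simp add: complex_eq_iff)
  then have "exp (c * of_real t) * y t = exp (c * of_real t) * (g / c)"
    by (simp add: y_def z0)
  moreover have "exp (c * of_real t) * y t = z t + g / c"
    by (simp add: y_def mult.assoc[symmetric] exp_minus)
  ultimately show ?thesis by (simp add: algebra_simps)
qed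

section \<open>Inverses, diagonal matrices and row selection\<close>

text \<open>A two-sided inverse makes \<open>X\<close> a unit of the matrix ring, so the option inside \<open>minv\<close> is not
  empty; uniqueness of inverses identifies its content.\<close>

lemma minv_eqI:
  fixes X Y :: "'a::field mat"
  assumes X: "X \<in> carrier_mat n n" and Y: "Y \<in> carrier_mat n n"
    and XY: "X * Y = 1\<^sub>m n" "Y * X = 1\<^sub>m n"
  shows "minv X = Y"
proof (cases "mat_inverse X")
  case None
  with mat_inverse(1)[OF X, of undefined] have "X \<notin> Units (ring_mat TYPE('a) n undefined)"
    by blast
  moreover have "X \<in> Units (ring_mat TYPE('a) n undefined)"
    unfolding Units_def using X Y XY by (auto simp: ring_mat_simps)
  ultimately show ?thesis by blast
next
  case (Some Z)
  then have Z: "Z * X = 1\<^sub>m n" "Z \<in> carrier_mat n n" using mat_inverse(2)[OF X] by auto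
  have "Z = Z * (X * Y)" using XY Z by simp
  also have "\<dots> = Y" using assoc_mult_mat[OF Z(2) X Y] Z Y by simp
  finally show ?thesis using Some by (simp add: minv_def)
qed

lemma invertible_mat_minv:
  fixes X :: "'a::field mat"
  assumes X: "X \<in> carrier_mat n n" and inv: "invertible_mat X"
  shows "minv X \<in> carrier_mat n n" "X * minv X = 1\<^sub>m n" "minv X * X = 1\<^sub>m n"
proof -
  obtain Y where Y: "X * Y = 1\<^sub>m n" "Y * X = 1\<^sub>m (dim_row Y)"
    using inv X unfolding invertible_mat_def inverts_mat_def by auto
  have "dim_row Y = n" using arg_cong[OF Y(2), of dim_col] X by simp
  moreover have "dim_col Y = n" using arg_cong[OF Y(1), of dim_col] by simp
  ultimately have "Y \<in> carrier_mat n n" by auto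
  with minv_eqI[OF X this] Y
  show "minv X \<in> carrier_mat n n" "X * minv X = 1\<^sub>m n" "minv X * X = 1\<^sub>m n" by auto
qed

lemma mult_mat_diag_vec:
  fixes f :: "nat \<Rightarrow> 'a::semiring_0"
  assumes v: "v \<in> carrier_vec n"
  shows "mat_diag n f *\<^sub>v v = vec n (\<lambda>i. f i * v $ i)"
proof (intro eq_vecI)
  fix i assume "i < dim_vec (vec n (\<lambda>i. f i * v $ i))"
  then show "(mat_diag n f *\<^sub>v v) $ i = vec n (\<lambda>i. f i * v $ i) $ i"
    using v by (simp add: mat_diag_def scalar_prod_def sum.remove[of _ i])
qed (simp add: mat_diag_def)

lemma diag_mult_vec_index:
  fixes u v :: "'a::semiring_0 vec"
  assumes "u \<in> carrier_vec n" "v \<in> carrier_vec n" "i < n"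
  shows "(diag u *\<^sub>v v) $ i = u $ i * v $ i"
  using assms mult_mat_diag_vec[of v n] by (simp add: diag_def)

lemma diag_carrier: "u \<in> carrier_vec n \<Longrightarrow> diag u \<in> carrier_mat n n"
  by (auto simp: diag_def mat_diag_def)

lemma diag_recip_carrier: "u \<in> carrier_vec n \<Longrightarrow> diag_recip u \<in> carrier_mat n n"
  by (simp add: diag_recip_def diag_carrier)

lemma diag_recip_mult_vec_index:
  assumes "u \<in> carrier_vec n" "v \<in> carrier_vec n" "i < n"
  shows "(diag_recip u *\<^sub>v v) $ i = v $ i / u $ i"
  using assms by (simp add: diag_recip_def diag_mult_vec_index[of _ n])

lemma minv_mat_diag:
  fixes f :: "nat \<Rightarrow> 'a::field"
  assumes "\<And>i. i < n \<Longrightarrow> f i \<noteq> 0"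
  shows "minv (mat_diag n f) = mat_diag n (\<lambda>i. 1 / f i)"
proof (rule minv_eqI)
  have "mat_diag n (\<lambda>i. f i * (1 / f i)) = 1\<^sub>m n" "mat_diag n (\<lambda>i. 1 / f i * f i) = 1\<^sub>m n"
    using assms by (auto simp: mat_diag_def intro!: eq_matI)
  then show "mat_diag n f * mat_diag n (\<lambda>i. 1 / f i) = 1\<^sub>m n"
      "mat_diag n (\<lambda>i. 1 / f i) * mat_diag n f = 1\<^sub>m n"
    by simp_all
qed auto

lemma pick_atLeast0LessThan: "i < n \<Longrightarrow> pick {0..<n} i = i"
proof -
  assume "i < n"
  then have "{a \<in> {0..<n}. a < i} = {0..<i}" by auto
  then show ?thesis using pick_card_in_set[of i "{0..<n}"] \<open>i < n\<close> by simp
qed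

lemma rows_N_eq:
  assumes "X \<in> carrier_mat N M" "n \<le> N"
  shows "rows_N n X = mat n M (\<lambda>(i, j). X $$ (i, j))"
proof -
  have "{i. i < dim_row X \<and> i \<in> {0..<n}} = {0..<n}" "{j. j < dim_col X \<and> j \<in> UNIV} = {0..<M}"
    using assms by auto
  then have card: "card {i. i < dim_row X \<and> i \<in> {0..<n}} = n"
      "card {j. j < dim_col X \<and> j \<in> UNIV} = M"
    by simp_all
  show ?thesis unfolding rows_N_def submatrix_def card
    by (rule eq_matI) (simp_all add: pick_atLeast0LessThan pick_UNIV)
qed

text \<open>Written as one diagonal with a case distinction, \<open>\<Lambda>\<close> and \<open>\<Lambda>\<close>-bar multiply and invert entrywise.\<close>

lemma Lam_eq_mat_diag:
  assumes "L1 \<in> carrier_mat k k" "diagonal_mat L1"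
  shows "Lam q L1 = mat_diag (k + q) (\<lambda>j. if j < k then L1 $$ (j, j) else 0)"
  using assms by (intro eq_matI) (auto simp: Lam_def mat_diag_def diagonal_mat_def)

lemma Lam_bar_eq_mat_diag:
  assumes "L1 \<in> carrier_mat k k" "diagonal_mat L1"
  shows "Lam_bar q L1 = mat_diag (k + q) (\<lambda>j. if j < k then L1 $$ (j, j) else - 1)"
  using assms by (intro eq_matI) (auto simp: Lam_bar_def mat_diag_def diagonal_mat_def)

lemma exp_Re_mat_diag:
  "exp_Re_Lam (mat_diag N f) t = vec N (\<lambda>j. exp (t * Re (f j)))"
proof (intro eq_vecI)
  fix i assume "i < dim_vec (vec N (\<lambda>j. exp (t * Re (f j))))"
  then have i: "i < N" by simp
  have "map_mat Re (mat_diag N f) = mat_diag N (\<lambda>j. Re (f j))"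
    by (intro eq_matI) (auto simp: mat_diag_def)
  then show "exp_Re_Lam (mat_diag N f) t $ i = vec N (\<lambda>j. exp (t * Re (f j))) $ i"
    using i carrier_matD[OF mat_diag_dim[of N f]] carrier_matD[OF mat_diag_dim[of N "\<lambda>j. Re (f j)"]]
    by (simp add: exp_Re_Lam_def mult_mat_diag_vec del: index_mult_mat_vec)
qed (simp add: exp_Re_Lam_def mat_diag_def)


section \<open>The kernel of the system matrix\<close>

lemma system_mat_carrier:
  assumes "d \<in> carrier_vec n" "h \<in> carrier_vec n" "b \<in> carrier_vec m"
    "tG \<in> carrier_vec n" "tV \<in> carrier_vec n" "r \<in> carrier_vec n"
  shows "system_mat G n m d h b tG tV r \<in> carrier_mat (3 * n + m) (3 * n + m)"
  using assms
  by (auto simp: system_mat_def Let_def diag_recip_def diag_def mat_diag_def incidence_mat_def)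

text \<open>The energy argument. In a steady state without disturbance no edge sees a frequency difference, so
  the network exchanges no power on balance, while damping and control both draw power wherever
  \<open>\<omega>\<^sub>i \<noteq> 0\<close>.\<close>

lemma system_mat_kernel_frequency_zero:
  assumes dims: "d \<in> carrier_vec n" "h \<in> carrier_vec n" "b \<in> carrier_vec m"
      "tG \<in> carrier_vec n" "tV \<in> carrier_vec n" "r \<in> carrier_vec n"
    and pos: "\<forall>i<n. d $ i > 0" "\<forall>i<n. h $ i > 0" "\<forall>e<m. b $ e > 0"
      "\<forall>i<n. tG $ i > 0" "\<forall>i<n. tV $ i > 0" "\<forall>i<n. r $ i > 0"
    and u: "u \<in> carrier_vec (3 * n + m)"
    and ker: "system_mat G n m d h b tG tV r *\<^sub>v u = 0\<^sub>v (3 * n + m)"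
    and i: "i < n"
  shows "u $ i = 0"
proof -
  define C where "C = incidence_mat G n m"
  define w where "w = vec_first u n"
  define p where "p = vec m (\<lambda>e. u $ (n + e))"
  define g where "g = vec n (\<lambda>j. u $ (n + m + j))"
  define v where "v = vec n (\<lambda>j. u $ (n + m + n + j))"
  have C: "C \<in> carrier_mat n m" by (simp add: C_def incidence_mat_def)
  have carr: "w \<in> carrier_vec n" "p \<in> carrier_vec m" "g \<in> carrier_vec n" "v \<in> carrier_vec n"
    by (simp_all add: w_def p_def g_def v_def)
  have u_eq: "u = (w @\<^sub>v p) @\<^sub>v (g @\<^sub>v v)"
    using u by (intro eq_vecI) (auto simp: w_def p_def g_def v_def vec_first_def)
  note dc = diag_carrier[OF dims(1)] diag_carrier[OF dims(3)] diag_carrier[OF dims(6)]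
    diag_recip_carrier[OF dims(2)] diag_recip_carrier[OF dims(4)] diag_recip_carrier[OF dims(5)]
  let ?a = "- (diag_recip h *\<^sub>v (diag d *\<^sub>v w)) - diag_recip h *\<^sub>v (C *\<^sub>v p) + diag_recip h *\<^sub>v g"
  let ?b = "diag b *\<^sub>v (transpose_mat C *\<^sub>v w)"
  let ?c = "- (diag_recip tG *\<^sub>v g) + diag_recip tG *\<^sub>v v"
  let ?e = "- (diag_recip tV *\<^sub>v (diag r *\<^sub>v w)) - diag_recip tV *\<^sub>v v"
  \<comment> \<open>The four block rows applied to \<open>(w, p, g, v)\<close>; the next four facts read them off entrywise.\<close>
  have "system_mat G n m d h b tG tV r *\<^sub>v u = (?a @\<^sub>v ?b) @\<^sub>v (?c @\<^sub>v ?e)"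
  proof -
    let ?M = "diag_recip h" and ?TG = "diag_recip tG" and ?TV = "diag_recip tV"
    let ?BL = "four_block_mat (- (?M * diag d)) (- (?M * C)) (diag b * transpose_mat C) (0\<^sub>m m m)"
    let ?BR = "four_block_mat ?M (0\<^sub>m n n) (0\<^sub>m m n) (0\<^sub>m m n)"
    let ?CL = "four_block_mat (0\<^sub>m n n) (0\<^sub>m n m) (- (?TV * diag r)) (0\<^sub>m n m)"
    let ?CR = "four_block_mat (- ?TG) ?TG (0\<^sub>m n n) (- ?TV)"
    have products: "?M * diag d \<in> carrier_mat n n" "?M * C \<in> carrier_mat n m"
      "diag b * transpose_mat C \<in> carrier_mat m n" "?TV * diag r \<in> carrier_mat n n"
      using dc C by (meson mult_carrier_mat transpose_carrier_mat)+
    have neg: "- X *\<^sub>v y = - (X *\<^sub>v y)"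
      if "X \<in> carrier_mat a c" "y \<in> carrier_vec c" for X :: "real mat" and y a c
      using that by (intro uminus_mult_mat_vec) auto
    have BL: "?BL *\<^sub>v (w @\<^sub>v p) = (- ((?M * diag d) *\<^sub>v w) + - ((?M * C) *\<^sub>v p))
        @\<^sub>v ((diag b * transpose_mat C) *\<^sub>v w + 0\<^sub>m m m *\<^sub>v p)"
      unfolding neg[OF products(1) carr(1), symmetric] neg[OF products(2) carr(2), symmetric]
      by (intro four_block_mat_mult_vec[of _ n n _ m _ m] uminus_carrier_mat products zero_carrier_mat carr)
    have BR: "?BR *\<^sub>v (g @\<^sub>v v) = (?M *\<^sub>v g + 0\<^sub>m n n *\<^sub>v v) @\<^sub>v (0\<^sub>m m n *\<^sub>v g + 0\<^sub>m m n *\<^sub>v v)"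
      using dc carr by (intro four_block_mat_mult_vec) auto
    have CL: "?CL *\<^sub>v (w @\<^sub>v p) = (0\<^sub>m n n *\<^sub>v w + 0\<^sub>m n m *\<^sub>v p)
        @\<^sub>v (- ((?TV * diag r) *\<^sub>v w) + 0\<^sub>m n m *\<^sub>v p)"
      unfolding neg[OF products(4) carr(1), symmetric]
      by (intro four_block_mat_mult_vec[of _ n n _ m _ n] uminus_carrier_mat products zero_carrier_mat carr)
    have CR: "?CR *\<^sub>v (g @\<^sub>v v) = (- (?TG *\<^sub>v g) + ?TG *\<^sub>v v) @\<^sub>v (0\<^sub>m n n *\<^sub>v g + - (?TV *\<^sub>v v))"
      unfolding neg[OF dc(5) carr(3), symmetric] neg[OF dc(6) carr(4), symmetric]
      by (intro four_block_mat_mult_vec[of _ n n _ n _ n] uminus_carrier_mat dc zero_carrier_mat carr)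
    have zero: "0\<^sub>m a c *\<^sub>v y = 0\<^sub>v a" if "y \<in> carrier_vec c" for y :: "real vec" and a c
      using that by (intro eq_vecI) auto
    have assoc: "(?M * diag d) *\<^sub>v w = ?M *\<^sub>v (diag d *\<^sub>v w)" "(?M * C) *\<^sub>v p = ?M *\<^sub>v (C *\<^sub>v p)"
      "(diag b * transpose_mat C) *\<^sub>v w = ?b" "(?TV * diag r) *\<^sub>v w = ?TV *\<^sub>v (diag r *\<^sub>v w)"
      using dc C carr by (meson assoc_mult_mat_vec transpose_carrier_mat)+
    have "system_mat G n m d h b tG tV r *\<^sub>v u
        = (?BL *\<^sub>v (w @\<^sub>v p) + ?BR *\<^sub>v (g @\<^sub>v v)) @\<^sub>v (?CL *\<^sub>v (w @\<^sub>v p) + ?CR *\<^sub>v (g @\<^sub>v v))"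
      unfolding u_eq system_mat_def Let_def C_def[symmetric]
      by (intro four_block_mat_mult_vec[of _ "n + m" "n + m" _ "n + n" _ "n + n"]
          four_block_carrier_mat append_carrier_vec uminus_carrier_mat products dc zero_carrier_mat carr)
    also have "\<dots> = (?a @\<^sub>v ?b) @\<^sub>v (?c @\<^sub>v ?e)"
      unfolding BL BR CL CR assoc using dc C carr
      by (intro eq_vecI) (auto simp: zero simp del: index_mult_mat_vec)
    finally show ?thesis .
  qed
  with ker have blocks: "(?a @\<^sub>v ?b) @\<^sub>v (?c @\<^sub>v ?e) = 0\<^sub>v (3 * n + m)" by simp
  have a0: "- (d $ j * w $ j) - (C *\<^sub>v p) $ j + g $ j = 0" if "j < n" for j
  proof -
    have "?a $ j = 0" using arg_cong[OF blocks, of "\<lambda>y. y $ j"] that dims dc C carr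
      by (simp del: index_mult_mat_vec)
    then have "(- (d $ j * w $ j) - (C *\<^sub>v p) $ j + g $ j) / h $ j = 0"
      using that dims dc C carr
      by (simp add: diag_recip_mult_vec_index[of _ n] diag_mult_vec_index[of _ n] diff_divide_distrib
          add_divide_distrib del: index_mult_mat_vec)
    then show ?thesis using pos(2) that by auto
  qed
  have b0: "(transpose_mat C *\<^sub>v w) $ e = 0" if "e < m" for e
  proof -
    have "?b $ e = 0" using arg_cong[OF blocks, of "\<lambda>y. y $ (n + e)"] that dims dc C carr
      by (simp del: index_mult_mat_vec)
    then show ?thesis using pos(3) that dims C carr
      by (auto simp: diag_mult_vec_index[of _ m] simp del: index_mult_mat_vec)
  qed
  have c0: "g $ j = v $ j" if "j < n" for j
  proof -
    have "?c $ j = 0" using arg_cong[OF blocks, of "\<lambda>y. y $ (n + m + j)"] that dims dc C carr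
      by (simp del: index_mult_mat_vec)
    then show ?thesis using pos(4) that dims dc carr
      by (auto simp: diag_recip_mult_vec_index[of _ n] field_simps simp del: index_mult_mat_vec)
  qed
  have e0: "v $ j = - (r $ j * w $ j)" if "j < n" for j
  proof -
    have "?e $ j = 0" using arg_cong[OF blocks, of "\<lambda>y. y $ (n + m + n + j)"] that dims dc C carr
      by (simp del: index_mult_mat_vec)
    then have "(r $ j * w $ j + v $ j) / tV $ j = 0" using that dims dc carr
      by (simp add: diag_recip_mult_vec_index[of _ n] diag_mult_vec_index[of _ n]
          add_divide_distrib del: index_mult_mat_vec)
    then show ?thesis using pos(5) that by auto
  qed
  have "(transpose_mat C *\<^sub>v w) \<bullet> p = 0"
    using b0 C carr by (auto simp: scalar_prod_def)
  then have "w \<bullet> (C *\<^sub>v p) = 0"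
    using transpose_vec_mult_scalar[OF C carr(2) carr(1)] by simp
  then have "(\<Sum>j<n. w $ j * (C *\<^sub>v p) $ j) = 0"
    using C by (simp add: scalar_prod_def atLeast0LessThan)
  moreover have "w $ j * (C *\<^sub>v p) $ j = - ((d $ j + r $ j) * (w $ j)\<^sup>2)" if "j < n" for j
  proof -
    have "(C *\<^sub>v p) $ j = - ((d $ j + r $ j) * w $ j)"
      using a0[OF that] c0[OF that] e0[OF that] by (simp add: algebra_simps)
    then show ?thesis by (simp add: power2_eq_square)
  qed
  ultimately have "(\<Sum>j<n. (d $ j + r $ j) * (w $ j)\<^sup>2) = 0"
    by (simp add: sum_negf)
  moreover have "(d $ j + r $ j) * (w $ j)\<^sup>2 \<ge> 0" if "j < n" for j
    using pos(1,6) that by (simp add: add_nonneg_nonneg less_imp_le)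
  ultimately have "(d $ i + r $ i) * (w $ i)\<^sup>2 = 0"
    using i by (subst (asm) sum_nonneg_eq_0_iff) auto
  then have "w $ i = 0" using pos(1,6) i by (smt (verit) mult_eq_0_iff zero_eq_power2)
  then show ?thesis using i u by (simp add: w_def vec_first_def)
qed

lemma map_mat_of_real_mult_vec_index:
  assumes "X \<in> carrier_mat N N" "u \<in> carrier_vec N" "i < N"
  shows "(X *\<^sub>v map_vec Re u) $ i = Re ((map_mat complex_of_real X *\<^sub>v u) $ i)"
    "(X *\<^sub>v map_vec Im u) $ i = Im ((map_mat complex_of_real X *\<^sub>v u) $ i)"
  using assms by (simp_all add: scalar_prod_def)

text \<open>Eigenvectors are complex, but \<open>A\<close> is real: the real and imaginary parts of a kernel vector lie
  in the kernel themselves, and the energy argument applies to each.\<close>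

lemma system_mat_complex_kernel_frequency_zero:
  assumes dims: "d \<in> carrier_vec n" "h \<in> carrier_vec n" "b \<in> carrier_vec m"
      "tG \<in> carrier_vec n" "tV \<in> carrier_vec n" "r \<in> carrier_vec n"
    and pos: "\<forall>i<n. d $ i > 0" "\<forall>i<n. h $ i > 0" "\<forall>e<m. b $ e > 0"
      "\<forall>i<n. tG $ i > 0" "\<forall>i<n. tV $ i > 0" "\<forall>i<n. r $ i > 0"
    and u: "u \<in> carrier_vec (3 * n + m)"
    and ker: "map_mat complex_of_real (system_mat G n m d h b tG tV r) *\<^sub>v u = 0\<^sub>v (3 * n + m)"
    and i: "i < n"
  shows "u $ i = 0"
proof -
  let ?A = "system_mat G n m d h b tG tV r"
  have A: "?A \<in> carrier_mat (3 * n + m) (3 * n + m)"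
    using dims by (rule system_mat_carrier)
  note * = map_mat_of_real_mult_vec_index[OF A u]
  have "?A *\<^sub>v map_vec Re u = 0\<^sub>v (3 * n + m)" "?A *\<^sub>v map_vec Im u = 0\<^sub>v (3 * n + m)"
    using A by (auto intro!: eq_vecI simp: * ker simp del: index_mult_mat_vec)
  then have "map_vec Re u $ i = 0" "map_vec Im u $ i = 0"
    using system_mat_kernel_frequency_zero[OF dims pos _ _ i] u by auto
  then show ?thesis using u i by (simp add: complex_eq_iff)
qed

section \<open>Solutions in eigencoordinates\<close>

text \<open>The rows of \<open>T\<close> are left eigenvectors of \<open>A\<close> (later \<open>T = S\<^sup>-\<^sup>1\<close>), so each coordinate of \<open>T x\<close>
  satisfies a scalar equation of its own.\<close>

lemma solves_from_zero_coordinate: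
  fixes A :: "real mat" and S :: "complex mat" and l :: "nat \<Rightarrow> complex"
  assumes A: "A \<in> carrier_mat N N" and P: "P \<in> carrier_vec N"
    and T: "T \<in> carrier_mat N N"
    and TA: "T * map_mat complex_of_real A = mat_diag N l * T"
    and sol: "solves_from_zero A P x" and t: "t \<ge> 0"
    and j: "j < N" and nz: "l j \<noteq> 0"
  shows "(T *\<^sub>v map_vec complex_of_real (x t)) $ j
    = (exp (l j * of_real t) - 1) * ((T *\<^sub>v map_vec complex_of_real P) $ j / l j)"
proof -
  let ?X = "\<lambda>s. map_vec complex_of_real (x s)"
  let ?P = "map_vec complex_of_real P"
  let ?A = "map_mat complex_of_real A"
  have x: "x s \<in> carrier_vec N" if "s \<ge> 0" for s
    using sol A that by (simp add: solves_from_zero_def)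
  have der: "((\<lambda>s. x s $ i) has_real_derivative (A *\<^sub>v x s + P) $ i) (at s within {0..})"
    if "s \<ge> 0" "i < N" for s i
    using sol A that
    by (auto simp: solves_from_zero_def)
  define z where "z s = (\<Sum>i<N. T $$ (j, i) * complex_of_real (x s $ i))" for s
  have z: "z s = (T *\<^sub>v ?X s) $ j" if "s \<ge> 0" for s
    using x[OF that] T j by (simp add: z_def scalar_prod_def atLeast0LessThan)
  have "z t = (exp (l j * of_real t) - 1) * ((T *\<^sub>v ?P) $ j / l j)"
  proof (rule scalar_affine_ode_from_zero[OF nz _ _ t])
    have "x 0 = 0\<^sub>v N" using sol A by (simp add: solves_from_zero_def)
    then show "z 0 = 0" by (simp add: z_def)
    fix s :: real assume s: "s \<ge> 0"
    have "(z has_vector_derivative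
        (\<Sum>i<N. T $$ (j, i) * complex_of_real ((A *\<^sub>v x s + P) $ i))) (at s within {0..})"
      unfolding z_def
      by (intro has_vector_derivative_sum
          bounded_linear.has_vector_derivative[OF bounded_linear_mult_right]
          has_vector_derivative_of_real der[OF s]) auto
    moreover have "(\<Sum>i<N. T $$ (j, i) * complex_of_real ((A *\<^sub>v x s + P) $ i))
        = l j * z s + (T *\<^sub>v ?P) $ j"
    proof -
      have "map_vec complex_of_real (A *\<^sub>v x s + P) = ?A *\<^sub>v ?X s + ?P"
        using A P x[OF s] by (intro eq_vecI) (auto simp: scalar_prod_def)
      then have "complex_of_real ((A *\<^sub>v x s + P) $ i) = (?A *\<^sub>v ?X s + ?P) $ i" if "i < N" for i
        using that P by (metis index_map_vec(1) index_add_vec(2) carrier_vecD)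
      then have "(\<Sum>i<N. T $$ (j, i) * complex_of_real ((A *\<^sub>v x s + P) $ i))
          = (\<Sum>i<N. row T j $ i * (?A *\<^sub>v ?X s + ?P) $ i)"
        using T j by (intro sum.cong) auto
      also have "\<dots> = (T *\<^sub>v (?A *\<^sub>v ?X s + ?P)) $ j"
        using P T j
        by (simp add: scalar_prod_def[of "row T j"] atLeast0LessThan index_add_vec(2) del: index_add_vec(1))
      also have "T *\<^sub>v (?A *\<^sub>v ?X s + ?P) = T *\<^sub>v (?A *\<^sub>v ?X s) + T *\<^sub>v ?P"
        using A P T x[OF s] by (intro mult_add_distrib_mat_vec[of _ N N]) auto
      also have "T *\<^sub>v (?A *\<^sub>v ?X s) = mat_diag N l *\<^sub>v (T *\<^sub>v ?X s)"
      proof -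
        have X: "?X s \<in> carrier_vec N" and A': "?A \<in> carrier_mat N N" using x[OF s] A by simp_all
        show ?thesis
          using assoc_mult_mat_vec[OF T A' X] assoc_mult_mat_vec[OF mat_diag_dim T X] TA by metis
      qed
      finally show ?thesis using T P j x[OF s] z[OF s]
        by (simp add: mult_mat_diag_vec[of _ N] del: index_mult_mat_vec)
    qed
    ultimately show "(z has_vector_derivative l j * z s + (T *\<^sub>v ?P) $ j) (at s within {0..})"
      by simp
  qed
  then show ?thesis using z[OF t] by simp
qed

section \<open>The bound on the frequency deviation\<close>

theorem theorem3p4:
  fixes G :: "(nat, nat) pre_digraph" and n m k q :: nat
    and d h b tG tV r pD :: "real vec"
    and A :: "real mat" and P :: "real vec"
    and S L1 :: "complex mat"
    and x :: "real \<Rightarrow> real vec" and t :: real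
  assumes graph: "digraph G" "verts G = {0..<n}" "arcs G = {0..<m}"
    and conn: "Digraph_Component.connected G"
    and dims: "d \<in> carrier_vec n" "h \<in> carrier_vec n" "b \<in> carrier_vec m"
      "tG \<in> carrier_vec n" "tV \<in> carrier_vec n" "r \<in> carrier_vec n" "pD \<in> carrier_vec n"
    and pos: "\<forall>i<n. d $ i > 0" "\<forall>i<n. h $ i > 0" "\<forall>e<m. b $ e > 0"
      "\<forall>i<n. tG $ i > 0" "\<forall>i<n. tV $ i > 0" "\<forall>i<n. r $ i > 0"
    and A_def: "A = system_mat G n m d h b tG tV r"
    and P_def: "P = disturbance_vec n m h pD"
    and S: "S \<in> carrier_mat (3 * n + m) (3 * n + m)" "invertible_mat S"
    and L1: "L1 \<in> carrier_mat k k" "diagonal_mat L1" "\<forall>i<k. L1 $$ (i, i) \<noteq> 0"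
    and kq: "k + q = 3 * n + m"
    and diagonalization: "map_mat complex_of_real A = S * Lam q L1 * minv S"
    and sol: "solves_from_zero A P x"
    and t: "t \<ge> 0"
  shows "map_vec abs (vec_first (x t) n)
       \<le> map_mat cmod (rows_N n (Y_mat S q L1 (map_vec complex_of_real P)))
            *\<^sub>v exp_Re_Lam (Lam q L1) t
          + map_vec cmod (omega_star n S q L1 (map_vec complex_of_real P))"
proof -
  define N where "N = 3 * n + m"
  define T where "T = minv S"
  define l where "l j = (if j < k then L1 $$ (j, j) else 0)" for j
  define lb where "lb j = (if j < k then L1 $$ (j, j) else - 1)" for j
  define Pc where "Pc = map_vec complex_of_real P"
  define g where "g = T *\<^sub>v Pc"
  define Y where "Y i j = S $$ (i, j) * g $ j / lb j" for i j
  note S' = S(1)[folded N_def]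
  note T = invertible_mat_minv[OF S' S(2), folded T_def]
  have A: "A \<in> carrier_mat N N" unfolding A_def N_def using dims by (intro system_mat_carrier)
  have P: "P \<in> carrier_vec N"
    using diag_recip_carrier[OF dims(2)]
    by (intro carrier_vecI) (auto simp: P_def disturbance_vec_def N_def)
  then have Pc: "Pc \<in> carrier_vec N" by (simp add: Pc_def)
  have g: "g \<in> carrier_vec N" using T Pc by (simp add: g_def)
  have L: "Lam q L1 = mat_diag N l" and Lb: "Lam_bar q L1 = mat_diag N lb"
    using Lam_eq_mat_diag[OF L1(1,2)] Lam_bar_eq_mat_diag[OF L1(1,2)] kq
    by (simp_all add: N_def l_def[abs_def] lb_def[abs_def])
  have lb: "lb j \<noteq> 0" if "j < N" for j using L1(3) by (simp add: lb_def)
  have nN: "n \<le> N" by (simp add: N_def)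
  let ?A = "map_mat complex_of_real A" and ?I = "mat_diag N (\<lambda>i. 1 / lb i)"
  have Ac: "?A \<in> carrier_mat N N" using A by simp
  have D: "mat_diag N f \<in> carrier_mat N N" for f :: "nat \<Rightarrow> complex" by simp
  have diago: "?A = S * mat_diag N l * T" using diagonalization by (simp add: L T_def)
  have TA: "T * ?A = mat_diag N l * T"
  proof -
    have "T * ?A = T * S * (mat_diag N l * T)" unfolding diago
      using assoc_mult_mat[OF S' D T(1)] assoc_mult_mat[OF T(1) S', of "mat_diag N l * T" N] T(1)
      by (simp add: mult_carrier_mat[OF D T(1)])
    then show ?thesis using T by (simp add: left_mult_one_mat[OF mult_carrier_mat[OF D T(1)]])
  qed
  have AS: "?A * S = S * mat_diag N l"
  proof -
    have "?A * S = S * mat_diag N l * (T * S)" unfolding diago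
      by (rule assoc_mult_mat[OF mult_carrier_mat[OF S' D] T(1) S'])
    then show ?thesis using T by (simp add: right_mult_one_mat[OF mult_carrier_mat[OF S' D]])
  qed
  \<comment> \<open>The columns of \<open>S\<close> from \<open>k\<close> on span the kernel of \<open>A\<close>.\<close>
  have S0: "S $$ (i, j) = 0" if "i < n" "k \<le> j" "j < N" for i j
  proof -
    have "?A *\<^sub>v col S j = col (S * mat_diag N l) j"
      using col_mult2[OF Ac S' that(3)] AS by simp
    also have "\<dots> = 0\<^sub>v N"
      using that S' by (intro eq_vecI) (auto simp: mat_diag_mult_right[OF S'] l_def)
    finally have "col S j $ i = 0"
      using system_mat_complex_kernel_frequency_zero[OF dims(1-6) pos _ _ that(1), of "col S j" G]
        S(1) that(3) unfolding A_def N_def by simp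
    then show ?thesis using that S' nN by simp
  qed
  have om: "omega_star n S q L1 Pc $ i = (\<Sum>j<N. Y i j)" if "i < n" for i
  proof -
    have SI: "S * ?I \<in> carrier_mat N N" and SB: "S * mat_diag N lb \<in> carrier_mat N N"
      using S' by auto
    have mult: "(S * mat_diag N f * T) * (S * mat_diag N f' * T) = 1\<^sub>m N"
      if "\<And>j. j < N \<Longrightarrow> f j * f' j = 1" for f f'
    proof -
      note DT = mult_carrier_mat[OF D T(1)] and SD = mult_carrier_mat[OF S' D]
      have "(S * mat_diag N f * T) * (S * mat_diag N f' * T)
          = S * mat_diag N f * (T * (S * (mat_diag N f' * T)))"
        using assoc_mult_mat[OF SD T(1) mult_carrier_mat[OF S' DT]] assoc_mult_mat[OF S' D T(1)]
        by simp
      also have "T * (S * (mat_diag N f' * T)) = mat_diag N f' * T"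
        using assoc_mult_mat[OF T(1) S' DT] T(3) left_mult_one_mat[OF DT] by simp
      also have "S * mat_diag N f * (mat_diag N f' * T) = S * (mat_diag N f * mat_diag N f' * T)"
        using assoc_mult_mat[OF S' D DT] assoc_mult_mat[OF D D T(1)] by simp
      also have "mat_diag N f * mat_diag N f' = 1\<^sub>m N"
        unfolding mat_diag_diag using that by (auto simp: mat_diag_def intro!: eq_matI)
      finally show ?thesis using T by simp
    qed
    have "A_bar S q L1 = S * mat_diag N lb * T" by (simp add: A_bar_def Lb T_def)
    then have "minv (A_bar S q L1) = S * ?I * T"
      using minv_eqI[OF mult_carrier_mat[OF SB T(1)] mult_carrier_mat[OF SI T(1)] mult mult] lb
      by simp
    then have "minv (A_bar S q L1) *\<^sub>v Pc = S *\<^sub>v (?I *\<^sub>v g)"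
      using assoc_mult_mat_vec[OF SI T(1) Pc] assoc_mult_mat_vec[OF S' D g] by (simp add: g_def)
    then show ?thesis using that nN S' g
      by (simp add: omega_star_def vec_first_def mult_mat_diag_vec scalar_prod_def
          atLeast0LessThan Y_def)
  qed
  have Ym: "rows_N n (Y_mat S q L1 Pc) = mat n N (\<lambda>(i, j). Y i j)"
  proof -
    have "Y_mat S q L1 Pc = mat N N (\<lambda>(i, j). Y i j)"
      using S' g by (auto simp: Y_mat_def Lb minv_mat_diag[OF lb] T_def[symmetric] g_def[symmetric]
          diag_def mat_diag_mult_right[of _ N N] Y_def intro!: eq_matI)
    then show ?thesis using nN by (auto simp: rows_N_eq[of _ N N] intro!: eq_matI)
  qed
  have xt: "x t \<in> carrier_vec N" using sol A t by (simp add: solves_from_zero_def)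
  \<comment> \<open>Termwise: below \<open>k\<close> the eigenvalue \<open>l j\<close> is nonzero and equals \<open>lb j\<close>; from \<open>k\<close> on,
    \<open>S $$ (i, j) = 0\<close> makes both sides vanish.\<close>
  have sol_eq: "complex_of_real (x t $ i)
      = (\<Sum>j<N. Y i j * exp (l j * of_real t)) - (\<Sum>j<N. Y i j)" if i: "i < n" for i
  proof -
    let ?X = "map_vec complex_of_real (x t)"
    have "?X = S *\<^sub>v (T *\<^sub>v ?X)"
      using xt assoc_mult_mat_vec[OF S' T(1), of ?X] T(2) by simp
    then have "complex_of_real (x t $ i) = (S *\<^sub>v (T *\<^sub>v ?X)) $ i"
      using xt i nN by (metis carrier_vecD index_map_vec(1) order_less_le_trans)
    also have "\<dots> = (\<Sum>j<N. S $$ (i, j) * (T *\<^sub>v ?X) $ j)"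
      using S' T(1) i nN by (simp add: scalar_prod_def atLeast0LessThan)
    also have "\<dots> = (\<Sum>j<N. Y i j * exp (l j * of_real t) - Y i j)"
    proof (intro sum.cong refl)
      fix j assume "j \<in> {..<N}"
      then have j: "j < N" by simp
      show "S $$ (i, j) * (T *\<^sub>v ?X) $ j = Y i j * exp (l j * of_real t) - Y i j"
      proof (cases "j < k")
        case True
        then have l: "l j \<noteq> 0" "lb j = l j" using L1(3) by (auto simp: l_def lb_def)
        have "(T *\<^sub>v ?X) $ j = (exp (l j * of_real t) - 1) * (g $ j / l j)"
          using solves_from_zero_coordinate[OF A P T(1) TA sol t j l(1)] by (simp only: g_def Pc_def)
        then have "S $$ (i, j) * (T *\<^sub>v ?X) $ j = (exp (l j * of_real t) - 1) * Y i j"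
          by (simp only: Y_def l(2) mult.left_commute times_divide_eq_right)
        then show ?thesis by (simp only: right_diff_distrib mult_1_right mult.commute[of _ "Y i j"])
      next
        case False
        then have "S $$ (i, j) = 0" by (intro S0 i j) simp
        then show ?thesis by (simp only: Y_def mult_zero_left div_0 diff_zero)
      qed
    qed
    finally show ?thesis by (simp only: sum_subtractf)
  qed
  show ?thesis unfolding less_eq_vec_def
  proof (intro conjI allI impI)
    show "dim_vec (map_vec abs (vec_first (x t) n)) = dim_vec
        (map_mat cmod (rows_N n (Y_mat S q L1 (map_vec complex_of_real P)))
            *\<^sub>v exp_Re_Lam (Lam q L1) t
          + map_vec cmod (omega_star n S q L1 (map_vec complex_of_real P)))"
      by (simp add: omega_star_def)
    fix i assume "i < dim_vec
        (map_mat cmod (rows_N n (Y_mat S q L1 (map_vec complex_of_real P)))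
            *\<^sub>v exp_Re_Lam (Lam q L1) t
          + map_vec cmod (omega_star n S q L1 (map_vec complex_of_real P)))"
    then have i: "i < n" by (simp add: omega_star_def)
    have "\<bar>x t $ i\<bar> = cmod ((\<Sum>j<N. Y i j * exp (l j * of_real t)) - (\<Sum>j<N. Y i j))"
      using sol_eq[OF i] by (metis norm_of_real)
    also have "\<dots> \<le> cmod (\<Sum>j<N. Y i j * exp (l j * of_real t)) + cmod (\<Sum>j<N. Y i j)"
      by (rule norm_triangle_ineq4)
    also have "cmod (\<Sum>j<N. Y i j * exp (l j * of_real t)) \<le> (\<Sum>j<N. cmod (Y i j) * exp (t * Re (l j)))"
      by (rule sum_norm_le) (simp add: norm_mult mult.commute)
    finally have "\<bar>x t $ i\<bar> \<le> (\<Sum>j<N. cmod (Y i j) * exp (t * Re (l j))) + cmod (\<Sum>j<N. Y i j)"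
      by simp
    then show "map_vec abs (vec_first (x t) n) $ i \<le>
        (map_mat cmod (rows_N n (Y_mat S q L1 (map_vec complex_of_real P)))
            *\<^sub>v exp_Re_Lam (Lam q L1) t
          + map_vec cmod (omega_star n S q L1 (map_vec complex_of_real P))) $ i"
      using i xt nN om[OF i] unfolding Pc_def[symmetric] Ym L exp_Re_mat_diag
      by (simp add: vec_first_def omega_star_def scalar_prod_def atLeast0LessThan)
  qed
qed

end
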